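(* Let $\{b_n\}_{n\ge1}$ be a probability distribution on the positive integers and $\{u_n\}_{n\ge 0}$ the corresponding renewal sequence. Suppose that $\sum_{n=1}^\infty b_nR^n\le L$ and $b_1\ge\beta$ for some constants $R>1$, $L<\infty$ and $\beta>0$. Let $N=(L-1)/(R-1)\ge1$, and let $R_1=R_1(\beta,R,L)$ be the unique solution $r\in(1,R)$ of the equation $$\frac{r-1}{r(\log (R/r))^2}=\frac{e^2\beta}{8N}.$$ Then the series $\sum_{n=1}^\infty(u_n-u_\infty)z^n$ has radius of convergence at least $R_1$. Moreover, for any $r\in(1,R_1)$, setting $$K_1=\frac{1}{r-1}\left(1+\frac{\beta+2(\log N)(\log (R/r))^{-1}}{\beta-8Ne^{-2}(r-1)r^{-1}(\log (R/r))^{-2}}\right),$$ we have $$\left|\sum_{n=0}^\infty(u_n-u_\infty)z^n\right|\le K_1\qquad\text{for all }|z|\le r.$$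
   Context: Discrete renewal theory: $V_1,V_2,\ldots$ are i.i.d. random variables with values in the positive integers, $b_n=\mathbf{P}(V_1=n)$ for $n\ge1$ (so $\sum_n b_n=1$), $T_0=0$, $T_k=V_1+\cdots+V_k$, and $u_n=\mathbf{P}(\text{there exists }k\ge0\text{ with }T_k=n)$ for $n\ge 0$. Then $\{u_n\}$ is called the renewal sequence corresponding to the increment sequence $\{b_n\}$; equivalently $u_0=1$ and $u_n=\sum_{k=1}^n b_ku_{n-k}$ for $n\ge1$. $u_\infty=\lim_{n\to\infty}u_n$ (the limit exists under the hypotheses). $z$ ranges over complex numbers. *)

theory Defs
  imports "HOL-Probability.Probability"
begin

text \<open>The increments are indexed from 1, as in \<open>T\<^sub>k = V\<^sub>1 + \<dots> + V\<^sub>k\<close>; \<open>V 0\<close> and \<open>b 0\<close>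
  are unconstrained and never used. That \<open>b\<close> sums to 1 over the positive integers follows
  from \<open>increment_pos\<close>.\<close>

locale renewal_process = prob_space M
  for M :: "'a measure" and V :: "nat \<Rightarrow> 'a \<Rightarrow> nat" and b :: "nat \<Rightarrow> real" +
  assumes increments_indep: "indep_vars (\<lambda>_. count_space UNIV) V {1..}"
    and increments_ident:
      "i \<ge> 1 \<Longrightarrow> distr M (count_space UNIV) (V i) = distr M (count_space UNIV) (V 1)"
    and increment_pos: "i \<ge> 1 \<Longrightarrow> \<omega> \<in> space M \<Longrightarrow> V i \<omega> \<ge> 1"
    and increment_prob: "n \<ge> 1 \<Longrightarrow> b n = prob {\<omega> \<in> space M. V 1 \<omega> = n}"

definition renewal_time :: "(nat \<Rightarrow> 'a \<Rightarrow> nat) \<Rightarrow> nat \<Rightarrow> 'a \<Rightarrow> nat" where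
  "renewal_time V k \<omega> = (\<Sum>i=1..k. V i \<omega>)"

definition renewal_seq :: "'a measure \<Rightarrow> (nat \<Rightarrow> 'a \<Rightarrow> nat) \<Rightarrow> nat \<Rightarrow> real" where
  "renewal_seq M V n = measure M {\<omega> \<in> space M. \<exists>k. renewal_time V k \<omega> = n}"

definition renewal_N :: "real \<Rightarrow> real \<Rightarrow> real" where
  "renewal_N R L = (L - 1) / (R - 1)"

definition is_R1 :: "real \<Rightarrow> real \<Rightarrow> real \<Rightarrow> real \<Rightarrow> bool" where
  "is_R1 \<beta> R L r \<longleftrightarrow> 1 < r \<and> r < R \<and>
     (r - 1) / (r * (ln (R / r))\<^sup>2) = exp 2 * \<beta> / (8 * renewal_N R L)"

definition renewal_R1 :: "real \<Rightarrow> real \<Rightarrow> real \<Rightarrow> real" where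
  "renewal_R1 \<beta> R L = (THE r. is_R1 \<beta> R L r)"

definition renewal_K1 :: "real \<Rightarrow> real \<Rightarrow> real \<Rightarrow> real \<Rightarrow> real" where
  "renewal_K1 \<beta> R L r =
     1 / (r - 1) *
       (1 + (\<beta> + 2 * ln (renewal_N R L) / ln (R / r)) /
            (\<beta> - 8 * renewal_N R L * exp (-2) * ((r - 1) / r) / (ln (R / r))\<^sup>2))"

end

theory Submission
  imports Defs "HOL-Complex_Analysis.Complex_Analysis"
begin

text \<open>Write \<open>c\<^sub>n = P(V\<^sub>1 > n)\<close> for the tails of the increments, \<open>c(z)\<close> for their generating function
and \<open>\<mu> = c(1)\<close> for the mean increment. Exactly one renewal time is the last one not after \<open>n\<close>, so
the convolution of the tails with \<open>u\<close> is constantly 1 (\<open>tail_convolution\<close>), that is, \<open>(1 - z) c(z) u(z) = 1\<close> as formal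
power series. Hence \<open>u\<^sub>n - 1/\<mu>\<close> has the generating function
\<open>(1/c(z) - 1/c(1)) / (1 - z)\<close> (\<open>fps_expansion_error_gf\<close>). The tails satisfy \<open>c(R) \<le> N\<close>, so \<open>c\<close> is holomorphic on \<open>\<bar>z\<bar> < R\<close>,
and the singularity at \<open>z = 1\<close> is removable. Everything therefore reduces to a lower bound for
\<open>\<bar>c(z)\<bar>\<close>: a Taylor series converges on the largest disc on which its sum is holomorphic, and on the
circle \<open>\<bar>z\<bar> = r\<close> one has \<open>\<bar>1 - z\<bar> \<ge> r - 1\<close> and \<open>\<mu> \<ge> 1\<close>, so the generating function is at most
\<open>(1 + 1/\<bar>c(z)\<bar>) / (r - 1)\<close> there. The maximum modulus principle carries this into the disc
(\<open>norm_error_gf_le\<close>).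

For the lower bound let \<open>z = r w\<close> with \<open>\<bar>w\<bar> = 1 \<le> r\<close> and \<open>t = \<bar>1 - w\<bar>\<close>. Two estimates are combined.

Near the positive axis, \<open>c(r w)\<close> is compared with \<open>c(r) \<ge> 1\<close>. The difference is at most \<open>t\<close> times the
sum of \<open>n c\<^sub>n r\<^sup>n\<close>, and by Jensen's inequality for the logarithm the mean of \<open>n\<close> under the weights
\<open>c\<^sub>n r\<^sup>n\<close> is at most \<open>B = ln N / ln (R/r)\<close>. This gives \<open>\<bar>c(r w)\<bar> \<ge> 1 - t B\<close>
(\<open>tail_gf_lower_bound_near_axis\<close>).

Away from the axis, summation by parts turns \<open>(1 - w) c(r w)\<close> into the series with terms
\<open>(r\<^sup>n b\<^sub>n\<^sub>+\<^sub>1 - (r - 1) r\<^sup>n c\<^sub>n\<^sub>+\<^sub>1) (1 - w\<^sup>n\<^sup>+\<^sup>1)\<close>. The real part of \<open>1 - w\<^sup>n\<close> lies between 0 and \<open>n\<^sup>2 t\<^sup>2/2\<close>, and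
for \<open>n = 1\<close> it equals \<open>t\<^sup>2/2\<close>. So \<open>b\<^sub>1\<close> alone contributes at least \<open>\<beta> t\<^sup>2/2\<close>, while the negative
part costs at most \<open>(r - 1) A t\<^sup>2/2\<close>, where \<open>A = 4 e\<^sup>-\<^sup>2 N / (r ln\<^sup>2 (R/r))\<close> comes from
\<open>x\<^sup>2 \<le> 4 e\<^sup>-\<^sup>2 e\<^sup>x\<close>. This gives \<open>\<bar>c(r w)\<bar> \<ge> t (\<beta> - (r - 1) A) / 2\<close>
(\<open>tail_gf_lower_bound_off_axis\<close>).

A positive combination of the two bounds eliminates \<open>t\<close> (\<open>tail_gf_lower_bound\<close>) and leaves
\<open>\<bar>c(z)\<bar> \<ge> (\<beta> - 2 (r - 1) A) / (\<beta> + 2 B)\<close>, and \<open>R\<^sub>1\<close> is the radius at which the numerator vanishes.\<close>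

section \<open>The renewal equation\<close>

context renewal_process
begin

lemma increments_real_indep: "indep_vars (\<lambda>_. borel) (\<lambda>i \<omega>. real (V i \<omega>)) {1..}"
  using increments_indep by (rule indep_vars_compose2) auto

lemma increment_measurable: "i \<ge> 1 \<Longrightarrow> V i \<in> measurable M (count_space UNIV)"
  using increments_indep by (auto simp: indep_vars_def2)

lemma real_renewal_time_measurable: "(\<lambda>\<omega>. real (renewal_time V k \<omega>)) \<in> borel_measurable M"
  unfolding renewal_time_def of_nat_sum
  using increments_real_indep by (intro borel_measurable_sum) (auto simp: indep_vars_def2)

lemma renewal_time_events: "{\<omega> \<in> space M. renewal_time V k \<omega> = n} \<in> events"
proof -
  have "{\<omega> \<in> space M. real (renewal_time V k \<omega>) = real n} \<in> events"
    using real_renewal_time_measurable[of k] by measurable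
  then show ?thesis
    by simp
qed

definition hit :: "nat \<Rightarrow> nat \<Rightarrow> real" where
  "hit k n = prob {\<omega> \<in> space M. renewal_time V k \<omega> = n}"

lemma increment_dist:
  assumes "i \<ge> 1" "n \<ge> 1"
  shows "prob {\<omega> \<in> space M. V i \<omega> = n} = b n"
proof -
  have "prob {\<omega> \<in> space M. V j \<omega> = n} = measure (distr M (count_space UNIV) (V j)) {n}" if "j \<ge> 1" for j
    using increment_measurable[OF that]
    by (subst measure_distr) (auto intro!: arg_cong[where f = prob])
  then show ?thesis
    using assms increments_ident[of i] increment_prob[of n] by simp
qed

lemma renewal_time_0 [simp]: "renewal_time V 0 \<omega> = 0"
  by (simp add: renewal_time_def)

lemma renewal_time_Suc: "renewal_time V (Suc k) \<omega> = renewal_time V k \<omega> + V (Suc k) \<omega>"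
  by (simp add: renewal_time_def)

lemma renewal_time_strict_mono:
  assumes "\<omega> \<in> space M"
  shows "strict_mono (\<lambda>k. renewal_time V k \<omega>)"
  using increment_pos[OF _ assms] by (intro strict_monoI_Suc) (auto simp: renewal_time_Suc Suc_le_eq)

lemma renewal_time_ge: "\<omega> \<in> space M \<Longrightarrow> renewal_time V k \<omega> \<ge> k"
  using strict_mono_imp_increasing[OF renewal_time_strict_mono] by simp

lemma hit_eq_0: "n < k \<Longrightarrow> hit k n = 0"
proof -
  assume "n < k"
  then have "{\<omega> \<in> space M. renewal_time V k \<omega> = n} = {}"
    using renewal_time_ge[of _ k] by fastforce
  then show ?thesis
    by (simp only: hit_def measure_empty)
qed

text \<open>The renewal equation is obtained by splitting off the last increment, because \<open>V\<^sub>k\<^sub>+\<^sub>1\<close> is independent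
of a partial sum \<open>T\<^sub>k\<close> of the same process. Splitting off the first one would lead to the
partial sums of the shifted process.\<close>

lemma renewal_step_indep:
  "prob {\<omega> \<in> space M. V (Suc k) \<omega> = Suc j \<and> renewal_time V k \<omega> = n} = b (Suc j) * hit k n"
proof -
  have "indep_vars (\<lambda>_. borel) (\<lambda>i \<omega>. real (V i \<omega>)) (insert (Suc k) {1..k})"
    using increments_real_indep by (rule indep_vars_subset) auto
  then have "indep_var borel (\<lambda>\<omega>. real (V (Suc k) \<omega>)) borel (\<lambda>\<omega>. \<Sum>i\<in>{1..k}. real (V i \<omega>))"
    by (rule indep_vars_sum[rotated 2]) auto
  then have indep: "indep_var borel (\<lambda>\<omega>. real (V (Suc k) \<omega>)) borel (\<lambda>\<omega>. real (renewal_time V k \<omega>))"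
    by (simp add: renewal_time_def)
  have "prob {\<omega> \<in> space M. V (Suc k) \<omega> = Suc j \<and> renewal_time V k \<omega> = n}
      = prob ((\<lambda>\<omega>. (real (V (Suc k) \<omega>), real (renewal_time V k \<omega>))) -` ({real (Suc j)} \<times> {real n}) \<inter> space M)"
    by (intro arg_cong[where f = prob]) (auto simp del: of_nat_Suc)
  also have "\<dots> = prob ((\<lambda>\<omega>. real (V (Suc k) \<omega>)) -` {real (Suc j)} \<inter> space M)
      * prob ((\<lambda>\<omega>. real (renewal_time V k \<omega>)) -` {real n} \<inter> space M)"
    by (rule indep_varD[OF indep]) auto
  also have "(\<lambda>\<omega>. real (V (Suc k) \<omega>)) -` {real (Suc j)} \<inter> space M = {\<omega> \<in> space M. V (Suc k) \<omega> = Suc j}"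
    by (auto simp del: of_nat_Suc)
  also have "(\<lambda>\<omega>. real (renewal_time V k \<omega>)) -` {real n} \<inter> space M = {\<omega> \<in> space M. renewal_time V k \<omega> = n}"
    by auto
  finally show ?thesis
    using increment_dist[of "Suc k" "Suc j"] by (simp add: hit_def)
qed

lemma hit_Suc: "hit (Suc k) (Suc m) = (\<Sum>j\<le>m. b (Suc j) * hit k (m - j))"
proof -
  define E where "E j = {\<omega> \<in> space M. V (Suc k) \<omega> = Suc j \<and> renewal_time V k \<omega> = m - j}" for j
  have "{\<omega> \<in> space M. renewal_time V (Suc k) \<omega> = Suc m} = (\<Union>j\<le>m. E j)"
  proof (intro equalityI subsetI)
    fix \<omega> assume \<omega>: "\<omega> \<in> {\<omega> \<in> space M. renewal_time V (Suc k) \<omega> = Suc m}"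
    then have "V (Suc k) \<omega> \<ge> 1"
      by (intro increment_pos) auto
    then have "\<omega> \<in> E (V (Suc k) \<omega> - 1)" "V (Suc k) \<omega> - 1 \<le> m"
      using \<omega> by (auto simp: E_def renewal_time_Suc)
    then show "\<omega> \<in> (\<Union>j\<le>m. E j)"
      by blast
  qed (auto simp: E_def renewal_time_Suc)
  moreover have "prob (\<Union>j\<le>m. E j) = (\<Sum>j\<le>m. prob (E j))"
  proof (rule finite_measure_finite_Union)
    have "E j = (V (Suc k) -` {Suc j} \<inter> space M) \<inter> {\<omega> \<in> space M. renewal_time V k \<omega> = m - j}" for j
      by (auto simp: E_def)
    then show "E ` {..m} \<subseteq> events"
      using renewal_time_events increment_measurable[of "Suc k"]
      by (auto intro!: sets.Int measurable_sets)
  qed (auto simp: E_def disjoint_family_on_def)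
  ultimately show ?thesis
    by (simp add: hit_def[of "Suc k"] E_def renewal_step_indep)
qed

text \<open>Renewal times increase strictly, so \<open>n\<close> is hit at most once, and by one of the times
\<open>T\<^sub>0, \<dots>, T\<^sub>n\<close>.\<close>

lemma renewal_seq_eq_sum_hit: "renewal_seq M V n = (\<Sum>k\<le>n. hit k n)"
proof -
  have "{\<omega> \<in> space M. \<exists>k. renewal_time V k \<omega> = n} = (\<Union>k\<le>n. {\<omega> \<in> space M. renewal_time V k \<omega> = n})"
    using renewal_time_ge by auto
  moreover have "prob (\<Union>k\<le>n. {\<omega> \<in> space M. renewal_time V k \<omega> = n}) = (\<Sum>k\<le>n. hit k n)"
    unfolding hit_def
  proof (rule finite_measure_finite_Union)
    show "disjoint_family_on (\<lambda>k. {\<omega> \<in> space M. renewal_time V k \<omega> = n}) {..n}"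
      using strict_mono_eq[OF renewal_time_strict_mono] by (auto simp: disjoint_family_on_def)
  qed (use renewal_time_events in auto)
  ultimately show ?thesis
    by (simp add: renewal_seq_def)
qed

lemma renewal_seq_0: "renewal_seq M V 0 = 1"
  by (simp add: renewal_seq_eq_sum_hit hit_def prob_space)

lemma renewal_equation:
  "renewal_seq M V (Suc m) = (\<Sum>j\<le>m. b (Suc j) * renewal_seq M V (m - j))"
proof -
  have "hit 0 (Suc m) = 0"
    by (simp add: hit_def)
  then have "renewal_seq M V (Suc m) = (\<Sum>k\<le>m. \<Sum>j\<le>m. b (Suc j) * hit k (m - j))"
    by (simp add: renewal_seq_eq_sum_hit sum.atMost_Suc_shift hit_Suc del: sum.atMost_Suc)
  also have "\<dots> = (\<Sum>j\<le>m. b (Suc j) * (\<Sum>k\<le>m. hit k (m - j)))"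
    by (subst sum.swap) (simp add: sum_distrib_left)
  also have "\<dots> = (\<Sum>j\<le>m. b (Suc j) * renewal_seq M V (m - j))"
  proof (intro sum.cong refl)
    fix j
    have "(\<Sum>k\<le>m. hit k (m - j)) = (\<Sum>k\<le>m - j. hit k (m - j))"
      by (rule sum.mono_neutral_right) (auto simp: hit_eq_0)
    then show "b (Suc j) * (\<Sum>k\<le>m. hit k (m - j)) = b (Suc j) * renewal_seq M V (m - j)"
      by (simp add: renewal_seq_eq_sum_hit)
  qed
  finally show ?thesis .
qed

lemma increment_dist_sums: "(\<lambda>n. b (Suc n)) sums 1"
proof -
  define E where "E n = {\<omega> \<in> space M. V 1 \<omega> = Suc n}" for n
  have "E n = V 1 -` {Suc n} \<inter> space M" for n
    by (auto simp: E_def)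
  then have "range E \<subseteq> events"
    using increment_measurable[of 1] by (auto intro!: measurable_sets)
  moreover have "disjoint_family E"
    by (auto simp: E_def disjoint_family_on_def)
  ultimately have "(\<lambda>n. prob (E n)) sums prob (\<Union>n. E n)"
    by (rule finite_measure_UNION)
  moreover have "(\<Union>n. E n) = space M"
  proof (intro equalityI subsetI)
    fix \<omega> assume "\<omega> \<in> space M"
    moreover have "V 1 \<omega> = Suc (V 1 \<omega> - 1)"
      using increment_pos[of 1 \<omega>] \<open>\<omega> \<in> space M\<close> by simp
    ultimately show "\<omega> \<in> (\<Union>n. E n)"
      by (auto simp: E_def)
  qed (auto simp: E_def)
  ultimately show ?thesis
    by (simp add: E_def increment_prob prob_space)
qed

end

section \<open>The equation that determines the radius\<close>

lemma rate_strict_mono: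
  fixes r s R :: real
  assumes "1 \<le> r" "r < s" "s < R"
  shows "(r - 1) / (r * (ln (R / r))\<^sup>2) < (s - 1) / (s * (ln (R / s))\<^sup>2)"
proof -
  have l: "0 < ln (R / s)" "ln (R / s) \<le> ln (R / r)"
    using assms by (auto simp: divide_left_mono)
  have "(r - 1) / r * (1 / (ln (R / r))\<^sup>2) < (s - 1) / s * (1 / (ln (R / s))\<^sup>2)"
  proof (rule mult_less_le_imp_less)
    show "(r - 1) / r < (s - 1) / s"
      using assms by (simp add: field_simps)
    show "1 / (ln (R / r))\<^sup>2 \<le> 1 / (ln (R / s))\<^sup>2"
      using l by (intro divide_left_mono power_mono mult_pos_pos zero_less_power) auto
  qed (use assms l in auto)
  then show ?thesis
    by simp
qed

text \<open>The left-hand side is singular at \<open>R\<close>, so the intermediate value theorem is applied to the equation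
with denominators cleared, which makes sense on the whole of \<open>[1, R]\<close>.\<close>

lemma rate_equation_ex1:
  fixes R \<kappa> :: real
  assumes "R > 1" "\<kappa> > 0"
  shows "\<exists>!r. 1 < r \<and> r < R \<and> (r - 1) / (r * (ln (R / r))\<^sup>2) = \<kappa>"
proof -
  define \<psi> where "\<psi> r = (r - 1) - \<kappa> * (r * (ln (R / r))\<^sup>2)" for r
  have "\<exists>r\<ge>1. r \<le> R \<and> \<psi> r = 0"
  proof (rule IVT')
    show "continuous_on {1..R} \<psi>"
      unfolding \<psi>_def using assms by (intro continuous_intros) auto
  qed (use assms in \<open>auto simp: \<psi>_def\<close>)
  then obtain r where r: "1 \<le> r" "r \<le> R" "\<psi> r = 0"
    by blast
  have "r \<noteq> 1" "r \<noteq> R"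
    using r assms by (auto simp: \<psi>_def)
  then have r': "1 < r" "r < R"
    using r by auto
  then have "(r - 1) / (r * (ln (R / r))\<^sup>2) = \<kappa>"
    using r(3) by (simp add: \<psi>_def field_simps)
  moreover have "s = r" if "1 < s" "s < R" "(s - 1) / (s * (ln (R / s))\<^sup>2) = \<kappa>" for s
    using rate_strict_mono[of r s R] rate_strict_mono[of s r R] that r' calculation
    by (cases s r rule: linorder_cases) auto
  ultimately show ?thesis
    using r' by blast
qed

section \<open>Tails of the increment distribution\<close>

text \<open>The maximum of \<open>x\<^sup>2 e\<^sup>-\<^sup>x\<close> is attained at \<open>x = 2\<close>; this is the source of the factor \<open>e\<^sup>2\<close> in the
equation for \<open>R\<^sub>1\<close>.\<close>

lemma square_mult_exp_le:
  fixes x :: real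
  assumes "x \<ge> 0"
  shows "x\<^sup>2 \<le> 4 * exp (-2) * exp x"
proof -
  have "x / 2 \<le> exp (x / 2 - 1)"
    using exp_ge_add_one_self[of "x / 2 - 1"] by simp
  then have "(x / 2)\<^sup>2 \<le> (exp (x / 2 - 1))\<^sup>2"
    using assms by (intro power_mono) auto
  also have "\<dots> = exp (-2) * exp x"
    by (simp add: exp_double[symmetric] flip: exp_add)
  finally show ?thesis
    by (simp add: power_divide)
qed

locale light_tailed_increments =
  fixes b :: "nat \<Rightarrow> real" and R L \<beta> :: real
  assumes R_gt_1: "R > 1" and \<beta>_pos: "\<beta> > 0"
    and b_nonneg: "b (Suc n) \<ge> 0"
    and b_sums: "(\<lambda>n. b (Suc n)) sums 1"
    and moment_summable: "summable (\<lambda>n. b (Suc n) * R ^ Suc n)"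
    and moment_le: "(\<Sum>n. b (Suc n) * R ^ Suc n) \<le> L"
    and b_1_ge: "b 1 \<ge> \<beta>"
begin

text \<open>The probability that an increment exceeds \<open>n\<close>. A finite sum is used instead of the infinite sum of
the \<open>b\<^sub>k\<close> with \<open>k > n\<close> so that the recursion in \<open>n\<close>, on which every summation by parts below rests,
is immediate.\<close>

definition tail :: "nat \<Rightarrow> real" where
  "tail n = 1 - (\<Sum>k<n. b (Suc k))"

lemma tail_0 [simp]: "tail 0 = 1"
  by (simp add: tail_def)

lemma tail_Suc: "tail (Suc n) = tail n - b (Suc n)"
  by (simp add: tail_def)

lemma tail_sums: "(\<lambda>k. b (Suc (k + n))) sums tail n"
  using sums_split_initial_segment[OF b_sums, of n] by (simp add: tail_def)

lemma tail_nonneg: "tail n \<ge> 0"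
  using sums_le[OF _ sums_zero tail_sums] b_nonneg by auto

lemma L_ge_R: "L \<ge> R"
proof -
  have "(\<lambda>n. b (Suc n) * R) sums (1 * R)"
    by (intro sums_mult2 b_sums)
  moreover have "b (Suc n) * R \<le> b (Suc n) * R ^ Suc n" for n
    using R_gt_1 b_nonneg by (intro mult_left_mono) (auto simp: one_le_power)
  ultimately have "1 * R \<le> (\<Sum>n. b (Suc n) * R ^ Suc n)"
    by (intro sums_le[OF _ _ summable_sums[OF moment_summable]])
  then show ?thesis
    using moment_le by simp
qed

lemma N_ge_1: "renewal_N R L \<ge> 1"
  using L_ge_R R_gt_1 by (simp add: renewal_N_def field_simps)

lemma tail_moment_partial: "(R - 1) * (\<Sum>n<m. tail n * R ^ n) = (\<Sum>n<m. b (Suc n) * R ^ Suc n) + tail m * R ^ m - 1"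
  by (induction m) (simp_all add: tail_Suc algebra_simps)

text \<open>This is \<open>(R - 1) c(R) = b(R) - 1\<close> for partial sums. The boundary term \<open>c\<^sub>m R\<^sup>m\<close> of the
summation by parts is absorbed by the remainder of the series for \<open>b(R)\<close>, since every increment
counted in \<open>c\<^sub>m\<close> exceeds \<open>m\<close>.\<close>

lemma tail_moment_partial_le: "(\<Sum>n<m. tail n * R ^ n) \<le> renewal_N R L"
proof -
  have "tail m * R ^ m \<le> (\<Sum>k. b (Suc (k + m)) * R ^ Suc (k + m))"
  proof (rule sums_le)
    show "(\<lambda>k. b (Suc (k + m)) * R ^ m) sums (tail m * R ^ m)"
      by (intro sums_mult2 tail_sums)
    show "b (Suc (k + m)) * R ^ m \<le> b (Suc (k + m)) * R ^ Suc (k + m)" for k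
      using R_gt_1 b_nonneg by (intro mult_left_mono power_increasing) auto
    show "(\<lambda>k. b (Suc (k + m)) * R ^ Suc (k + m)) sums (\<Sum>k. b (Suc (k + m)) * R ^ Suc (k + m))"
      using summable_ignore_initial_segment[OF moment_summable, of m] by (simp add: summable_sums)
  qed
  moreover have "(\<Sum>n. b (Suc n) * R ^ Suc n)
      = (\<Sum>k. b (Suc (k + m)) * R ^ Suc (k + m)) + (\<Sum>n<m. b (Suc n) * R ^ Suc n)"
    by (rule suminf_split_initial_segment[OF moment_summable])
  ultimately have "(R - 1) * (\<Sum>n<m. tail n * R ^ n) \<le> L - 1"
    using moment_le tail_moment_partial[of m] by linarith
  then show ?thesis
    using R_gt_1 by (simp add: renewal_N_def field_simps)
qed

lemma tail_moment_summable: "summable (\<lambda>n. tail n * R ^ n)"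
proof (rule bounded_imp_summable)
  show "(\<Sum>n\<le>m. tail n * R ^ n) \<le> renewal_N R L" for m
    using tail_moment_partial_le[of "Suc m"] by (simp only: lessThan_Suc_atMost)
qed (use R_gt_1 tail_nonneg in auto)

lemma tail_moment_le: "(\<Sum>n. tail n * R ^ n) \<le> renewal_N R L"
  by (rule suminf_le_const[OF tail_moment_summable tail_moment_partial_le])

lemma tail_power_summable:
  assumes "0 \<le> r" "r \<le> R"
  shows "summable (\<lambda>n. tail n * r ^ n)"
  by (rule summable_comparison_test_ev[OF _ tail_moment_summable])
     (use assms tail_nonneg in \<open>auto intro!: always_eventually mult_left_mono power_mono\<close>)

lemma tail_suminf_ge_1:
  assumes "0 \<le> r" "r \<le> R"
  shows "(\<Sum>n. tail n * r ^ n) \<ge> 1"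
  using sum_le_suminf[OF tail_power_summable[OF assms], of "{..<1}"] assms tail_nonneg by auto

text \<open>Jensen's inequality for the logarithm under the weights \<open>c\<^sub>n r\<^sup>n\<close>, of total mass \<open>W \<ge> 1\<close>: the mean of
\<open>n ln (R/r) = ln ((R/r)\<^sup>n)\<close> is at most the logarithm of the mean of \<open>(R/r)\<^sup>n\<close>, and the latter is
\<open>c(R)/W \<le> N\<close>. The proof applies the tangent bound \<open>ln y \<le> y - 1\<close> termwise, at the point \<open>N\<close>.\<close>

lemma tail_log_moment:
  assumes r: "0 < r" "r < R"
  defines "W \<equiv> (\<Sum>n. tail n * r ^ n)"
  shows "summable (\<lambda>n. real n * (tail n * r ^ n))"
    and "(\<Sum>n. real n * (tail n * r ^ n)) \<le> W * (ln (renewal_N R L) / ln (R / r))"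
proof -
  define N where "N = renewal_N R L"
  have N: "N \<ge> 1"
    using N_ge_1 by (simp add: N_def)
  define x where "x = R / r"
  have x: "x > 1" "ln x > 0"
    using r by (auto simp: x_def)
  define f where "f n = ((ln N - 1) * (tail n * r ^ n) + tail n * R ^ n / N) / ln x" for n
  have f_sums: "f sums (((ln N - 1) * W + (\<Sum>n. tail n * R ^ n) / N) / ln x)"
    unfolding f_def W_def using r
    by (intro sums_divide sums_add sums_mult summable_sums tail_moment_summable tail_power_summable) auto
  have le: "real n * (tail n * r ^ n) \<le> f n" for n
  proof -
    have "ln (x ^ n / N) \<le> x ^ n / N - 1"
      using x N by (intro ln_le_minus_one) auto
    then have "real n * ln x \<le> ln N - 1 + x ^ n / N"
      using x N by (simp add: ln_div ln_realpow)
    then have "real n * ln x * (tail n * r ^ n) \<le> (ln N - 1 + x ^ n / N) * (tail n * r ^ n)"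
      using r tail_nonneg by (intro mult_right_mono) auto
    also have "\<dots> = f n * ln x"
      using r x by (simp add: f_def x_def field_simps)
    finally show ?thesis
      using x by (simp add: mult.commute mult.left_commute)
  qed
  show sm: "summable (\<lambda>n. real n * (tail n * r ^ n))"
    by (rule summable_comparison_test_ev[OF _ sums_summable[OF f_sums]])
       (use le r tail_nonneg in \<open>auto intro!: always_eventually\<close>)
  have "(\<Sum>n. real n * (tail n * r ^ n)) \<le> ((ln N - 1) * W + (\<Sum>n. tail n * R ^ n) / N) / ln x"
    using sums_le[OF le summable_sums[OF sm] f_sums] .
  also have "\<dots> \<le> ((ln N - 1) * W + 1) / ln x"
    using tail_moment_le N x by (intro divide_right_mono add_left_mono) (auto simp: N_def)
  also have "\<dots> \<le> (ln N * W) / ln x"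
    using tail_suminf_ge_1[of r] r x unfolding W_def by (intro divide_right_mono) (auto simp: algebra_simps)
  finally show "(\<Sum>n. real n * (tail n * r ^ n)) \<le> W * (ln (renewal_N R L) / ln (R / r))"
    by (simp add: N_def x_def mult.commute)
qed

text \<open>The bound \<open>x\<^sup>2 \<le> 4 e\<^sup>-\<^sup>2 e\<^sup>x\<close> at \<open>x = n ln (R/r)\<close> trades the factor \<open>n\<^sup>2\<close> for the growth of the
weights from \<open>r\<^sup>n\<close> to \<open>R\<^sup>n\<close>.\<close>

lemma tail_second_moment:
  assumes r: "0 < r" "r < R"
  shows "summable (\<lambda>n. (real n)\<^sup>2 * (tail n * r ^ n))"
    and "(\<Sum>n. (real n)\<^sup>2 * (tail n * r ^ n)) \<le> 4 * exp (-2) * renewal_N R L / (ln (R / r))\<^sup>2"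
proof -
  define K where "K = 4 * exp (-2) / (ln (R / r))\<^sup>2"
  have l: "ln (R / r) > 0"
    using r by simp
  have le: "(real n)\<^sup>2 * (tail n * r ^ n) \<le> K * (tail n * R ^ n)" for n
  proof -
    have "(real n * ln (R / r))\<^sup>2 \<le> 4 * exp (-2) * exp (real n * ln (R / r))"
      using l by (intro square_mult_exp_le) auto
    also have "exp (real n * ln (R / r)) = (R / r) ^ n"
      using r by (simp add: exp_of_nat_mult)
    finally have "(real n)\<^sup>2 \<le> K * (R / r) ^ n"
      using l by (simp add: K_def power_mult_distrib pos_le_divide_eq)
    then have "(real n)\<^sup>2 * (tail n * r ^ n) \<le> K * (R / r) ^ n * (tail n * r ^ n)"
      using r tail_nonneg by (intro mult_right_mono) auto
    also have "\<dots> = K * (tail n * R ^ n)"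
      using r by (simp add: power_divide)
    finally show ?thesis .
  qed
  have K_sums: "(\<lambda>n. K * (tail n * R ^ n)) sums (K * (\<Sum>n. tail n * R ^ n))"
    by (intro sums_mult summable_sums tail_moment_summable)
  show sm: "summable (\<lambda>n. (real n)\<^sup>2 * (tail n * r ^ n))"
    by (rule summable_comparison_test_ev[OF _ sums_summable[OF K_sums]])
       (use le r tail_nonneg in \<open>auto intro!: always_eventually\<close>)
  have "(\<Sum>n. (real n)\<^sup>2 * (tail n * r ^ n)) \<le> K * (\<Sum>n. tail n * R ^ n)"
    using sums_le[OF le summable_sums[OF sm] K_sums] .
  also have "\<dots> \<le> K * renewal_N R L"
    using tail_moment_le by (intro mult_left_mono) (auto simp: K_def)
  finally show "(\<Sum>n. (real n)\<^sup>2 * (tail n * r ^ n)) \<le> 4 * exp (-2) * renewal_N R L / (ln (R / r))\<^sup>2"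
    by (simp add: K_def)
qed

section \<open>The generating function of the tails\<close>

definition tail_fps :: "complex fps" where
  "tail_fps = Abs_fps (\<lambda>n. complex_of_real (tail n))"

definition tail_gf :: "complex \<Rightarrow> complex" where
  "tail_gf = eval_fps tail_fps"

lemma tail_fps_radius: "fps_conv_radius tail_fps \<ge> ereal R"
proof -
  have "summable (\<lambda>n. complex_of_real (tail n) * complex_of_real R ^ n)"
    using tail_moment_summable summable_of_real[of "\<lambda>n. tail n * R ^ n", where 'a=complex] by simp
  then have "conv_radius (\<lambda>n. complex_of_real (tail n)) \<ge> ereal (norm (complex_of_real R))"
    by (rule conv_radius_geI)
  then show ?thesis
    using R_gt_1 by (simp add: tail_fps_def fps_conv_radius_def)
qed

lemma tail_gf_holomorphic: "tail_gf holomorphic_on ball 0 R"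
proof -
  have "ball 0 R \<subseteq> eball 0 (fps_conv_radius tail_fps)"
    using tail_fps_radius by (meson ball_eball_mono ereal_less_eq)
  then show ?thesis
    unfolding tail_gf_def by (rule holomorphic_on_eval_fps)
qed

lemma tail_gf_sums:
  assumes "0 \<le> r" "r < R" "norm w \<le> 1"
  shows "(\<lambda>n. of_real (tail n * r ^ n) * w ^ n) sums tail_gf (of_real r * w)"
proof -
  have "norm (of_real r * w) < R"
    using assms mult_left_le[of "norm w" r] by (simp add: norm_mult)
  then have "ereal (norm (of_real r * w)) < fps_conv_radius tail_fps"
    using tail_fps_radius by (meson ereal_less_eq(3) less_ereal.simps(1) order_less_le_trans)
  then have "(\<lambda>n. fps_nth tail_fps n * (of_real r * w) ^ n) sums tail_gf (of_real r * w)"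
    unfolding tail_gf_def by (rule sums_eval_fps)
  then show ?thesis
    by (simp add: tail_fps_def power_mult_distrib mult.assoc)
qed

lemma tail_gf_real_sums:
  assumes "0 \<le> r" "r < R"
  shows "tail_gf (of_real r) = of_real (\<Sum>n. tail n * r ^ n)"
proof -
  have "(\<lambda>n. complex_of_real (tail n * r ^ n)) sums of_real (\<Sum>n. tail n * r ^ n)"
    using tail_power_summable[of r] assms by (intro sums_of_real summable_sums) auto
  moreover have "(\<lambda>n. complex_of_real (tail n * r ^ n)) sums tail_gf (of_real r)"
    using tail_gf_sums[of r 1] assms by simp
  ultimately show ?thesis
    using sums_unique2 by blast
qed

text \<open>The mean increment, as the sum of its tail probabilities.\<close>

definition mean :: real where
  "mean = (\<Sum>n. tail n)"

lemma mean_ge_1: "mean \<ge> 1"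
  using tail_suminf_ge_1[of 1] R_gt_1 by (simp add: mean_def)

lemma tail_gf_1: "tail_gf 1 = of_real mean"
  using tail_gf_real_sums[of 1] R_gt_1 by (simp add: mean_def)

section \<open>Lower bounds for the generating function of the tails\<close>

lemma norm_one_minus_power_le:
  fixes w :: complex
  assumes "norm w \<le> 1"
  shows "norm (1 - w ^ n) \<le> real n * norm (1 - w)"
proof -
  have "norm (1 ^ n - w ^ n) \<le> of_nat n * norm (1 - w)"
    by (rule norm_power_diff) (use assms in auto)
  then show ?thesis
    by (simp only: power_one)
qed

lemma one_minus_Re_unit:
  assumes "norm w = 1"
  shows "1 - Re w = (norm (1 - w))\<^sup>2 / 2"
proof -
  have "(norm w)\<^sup>2 = 1"
    using assms by simp
  then show ?thesis
    unfolding cmod_power2 by (simp add: power2_eq_square algebra_simps)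
qed

text \<open>The comparison point is \<open>c(r) = W\<close>. The logarithmic moment bounds the difference by \<open>W t B\<close>, and the
factor \<open>W\<close>, which is at least 1, can then be dropped from \<open>W (1 - t B)\<close>.\<close>

lemma tail_gf_lower_bound_near_axis:
  assumes r: "1 \<le> r" "r < R" and w: "norm w = 1"
  shows "norm (tail_gf (of_real r * w)) \<ge> 1 - norm (1 - w) * (ln (renewal_N R L) / ln (R / r))"
proof (cases "norm (1 - w) * (ln (renewal_N R L) / ln (R / r)) \<le> 1")
  case True
  define B where "B = ln (renewal_N R L) / ln (R / r)"
  define W where "W = (\<Sum>n. tail n * r ^ n)"
  have W: "W \<ge> 1"
    using tail_suminf_ge_1[of r] r by (simp add: W_def)
  have diff: "(\<lambda>n. of_real (tail n * r ^ n) * (1 - w ^ n)) sums (of_real W - tail_gf (of_real r * w))"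
    using sums_diff[OF tail_gf_sums[of r 1] tail_gf_sums[of r w]] r w
    by (simp add: tail_gf_real_sums W_def algebra_simps)
  have "norm (of_real W - tail_gf (of_real r * w)) \<le> norm (1 - w) * (\<Sum>n. real n * (tail n * r ^ n))"
  proof (rule norm_sums_le[OF diff])
    show "(\<lambda>n. norm (1 - w) * (real n * (tail n * r ^ n))) sums (norm (1 - w) * (\<Sum>n. real n * (tail n * r ^ n)))"
      using r by (intro sums_mult summable_sums tail_log_moment(1)) auto
    show "norm (of_real (tail n * r ^ n) * (1 - w ^ n)) \<le> norm (1 - w) * (real n * (tail n * r ^ n))" for n
    proof -
      have "norm (of_real (tail n * r ^ n) * (1 - w ^ n)) = tail n * r ^ n * norm (1 - w ^ n)"
        using r tail_nonneg[of n] by (simp add: norm_mult norm_power)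
      also have "\<dots> \<le> tail n * r ^ n * (real n * norm (1 - w))"
        using norm_one_minus_power_le[of w n] w r tail_nonneg[of n] by (intro mult_left_mono) auto
      finally show ?thesis
        by (simp add: mult_ac)
    qed
  qed
  also have "\<dots> \<le> norm (1 - w) * (W * B)"
    using tail_log_moment(2)[of r] r unfolding W_def B_def by (intro mult_left_mono) auto
  finally have "norm (tail_gf (of_real r * w)) \<ge> W * (1 - norm (1 - w) * B)"
    using norm_triangle_ineq2[of "of_real W" "of_real W - tail_gf (of_real r * w)"] W
    by (simp add: algebra_simps)
  moreover have "W * (1 - norm (1 - w) * B) \<ge> 1 * (1 - norm (1 - w) * B)"
    using W True unfolding B_def by (intro mult_right_mono) auto
  ultimately show ?thesis
    by (simp add: B_def)
next
  case False
  \<comment> \<open>The claimed bound is negative, and \<open>W\<close> could not be dropped.\<close>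
  then show ?thesis
    using norm_ge_zero[of "tail_gf (of_real r * w)"] by linarith
qed

text \<open>Multiplication by \<open>1 - w\<close> telescopes the powers of \<open>w\<close>, as
\<open>w\<^sup>n - w\<^sup>n\<^sup>+\<^sup>1 = (1 - w\<^sup>n\<^sup>+\<^sup>1) - (1 - w\<^sup>n)\<close>. Writing the result with \<open>1 - w\<^sup>n\<^sup>+\<^sup>1\<close>
instead of \<open>w\<^sup>n\<^sup>+\<^sup>1\<close> is what makes real parts useful: these factors have nonnegative real part,
which is of second order in \<open>1 - w\<close> on the unit circle.\<close>

lemma abel_summation:
  assumes "0 \<le> r" "r < R" "norm w \<le> 1"
  shows "(\<lambda>n. of_real (tail n * r ^ n - tail (Suc n) * r ^ Suc n) * (1 - w ^ Suc n))
           sums ((1 - w) * tail_gf (of_real r * w))"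
proof -
  define d where "d n = tail n * r ^ n" for n
  have d_nonneg: "d n \<ge> 0" for n
    using assms tail_nonneg by (simp add: d_def)
  have d_summable: "summable d"
    using tail_power_summable[of r] assms unfolding d_def by simp
  have summ: "summable (\<lambda>n. complex_of_real (d n) * (1 - w ^ k n))" for k :: "nat \<Rightarrow> nat"
  proof (rule summable_comparison_test_ev)
    show "summable (\<lambda>n. d n * 2)"
      using d_summable by (rule summable_mult2)
    have "norm (1 - w ^ k n) \<le> 2" for n
      using norm_triangle_ineq4[of 1 "w ^ k n"] assms power_le_one[of "norm w" "k n"] by (simp add: norm_power)
    then show "\<forall>\<^sub>F n in sequentially. norm (complex_of_real (d n) * (1 - w ^ k n)) \<le> d n * 2"
      using d_nonneg by (intro always_eventually allI) (auto simp: norm_mult intro!: mult_left_mono)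
  qed
  define s where "s = (\<Sum>n. complex_of_real (d n) * (1 - w ^ n))"
  define s' where "s' = (\<Sum>n. complex_of_real (d n) * (1 - w ^ Suc n))"
  have s: "(\<lambda>n. complex_of_real (d n) * (1 - w ^ n)) sums s"
    using summ[of "\<lambda>n. n"] by (simp add: s_def summable_sums)
  have s': "(\<lambda>n. complex_of_real (d n) * (1 - w ^ Suc n)) sums s'"
    using summ[of Suc] unfolding s'_def by (rule summable_sums)
  have "(\<lambda>n. (1 - w) * (of_real (d n) * w ^ n)) sums (s' - s)"
    using sums_diff[OF s' s] by (simp add: algebra_simps)
  moreover have "(\<lambda>n. (1 - w) * (of_real (d n) * w ^ n)) sums ((1 - w) * tail_gf (of_real r * w))"
    using tail_gf_sums[OF assms] unfolding d_def by (rule sums_mult)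
  ultimately have "(1 - w) * tail_gf (of_real r * w) = s' - s"
    by (rule sums_unique2[THEN sym])
  moreover have "(\<lambda>n. complex_of_real (d (Suc n)) * (1 - w ^ Suc n)) sums s"
    using s by (subst sums_Suc_iff) simp
  ultimately show ?thesis
    using sums_diff[OF s', of "\<lambda>n. complex_of_real (d (Suc n)) * (1 - w ^ Suc n)" s]
    by (simp only: d_def of_real_diff left_diff_distrib)
qed

text \<open>For \<open>r = 1\<close> summation by parts has the coefficients \<open>b\<^sub>n\<^sub>+\<^sub>1 \<ge> 0\<close>, so the real part of \<open>(1 - z) c(z)\<close> is at
least \<open>b\<^sub>1 (1 - Re z)\<close>, which is positive unless \<open>z = 1\<close>.\<close>

lemma tail_gf_nonzero_unit_disc:
  assumes "norm z \<le> 1"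
  shows "tail_gf z \<noteq> 0"
proof (cases "z = 1")
  case True
  then show ?thesis
    using tail_gf_real_sums[of 1] tail_suminf_ge_1[of 1] R_gt_1 by auto
next
  case False
  have sums: "(\<lambda>n. b (Suc n) * (1 - Re (z ^ Suc n))) sums Re ((1 - z) * tail_gf z)"
    using sums_Re[OF abel_summation[of 1 z]] assms R_gt_1 by (simp add: tail_Suc)
  have nonneg: "0 \<le> b (Suc n) * (1 - Re (z ^ Suc n))" for n
  proof (rule mult_nonneg_nonneg[OF b_nonneg])
    have "norm (z ^ Suc n) \<le> 1"
      using assms by (simp only: norm_power power_le_one norm_ge_zero)
    then show "0 \<le> 1 - Re (z ^ Suc n)"
      using complex_Re_le_cmod[of "z ^ Suc n"] by linarith
  qed
  have "Re z \<noteq> 1"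
  proof
    assume "Re z = 1"
    then have "1 + (Im z)\<^sup>2 \<le> 1"
      using assms cmod_power2[of z] power_le_one[of "norm z" 2] by simp
    then show False
      using False \<open>Re z = 1\<close> by (simp add: complex_eq_iff)
  qed
  then have "0 < b (Suc 0) * (1 - Re (z ^ Suc 0))"
    using complex_Re_le_cmod[of z] assms b_1_ge \<beta>_pos by simp
  then have "0 < (\<Sum>n. b (Suc n) * (1 - Re (z ^ Suc n)))"
    by (rule suminf_pos2[OF sums_summable[OF sums] nonneg])
  then have "Re ((1 - z) * tail_gf z) > 0"
    using sums_unique[OF sums] by simp
  then show ?thesis
    by auto
qed

text \<open>The differences of \<open>c\<^sub>n r\<^sup>n\<close> are \<open>r\<^sup>n b\<^sub>n\<^sub>+\<^sub>1 - (r - 1) r\<^sup>n c\<^sub>n\<^sub>+\<^sub>1\<close>. After summation by parts, the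
positive parts are bounded below by the contribution of \<open>b\<^sub>1\<close>, and the negative ones by the second
moment of the tails. Both are multiples of \<open>t\<^sup>2\<close>, so that dividing by \<open>\<bar>1 - w\<bar> = t\<close> leaves a bound
of order \<open>t\<close>.\<close>

lemma tail_gf_lower_bound_off_axis:
  assumes r: "1 \<le> r" "r < R" and w: "norm w = 1"
  defines "A \<equiv> 4 * exp (-2) * renewal_N R L / (r * (ln (R / r))\<^sup>2)"
  shows "norm (tail_gf (of_real r * w)) \<ge> norm (1 - w) / 2 * (\<beta> - (r - 1) * A)"
proof (cases "w = 1")
  case False
  define t where "t = norm (1 - w)"
  have t: "t > 0"
    using False by (simp add: t_def)
  have Re_nonneg: "0 \<le> 1 - Re (w ^ n)" for n
    by (subst one_minus_Re_unit) (use w in \<open>auto simp: norm_power\<close>)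
  have Re_le: "1 - Re (w ^ n) \<le> (real n)\<^sup>2 * (t\<^sup>2 / 2)" for n
  proof -
    have "(norm (1 - w ^ n))\<^sup>2 \<le> (real n * t)\<^sup>2"
      using norm_one_minus_power_le[of w n] w by (intro power_mono) (auto simp: t_def)
    then show ?thesis
      using one_minus_Re_unit[of "w ^ n"] w by (simp add: norm_power power_mult_distrib)
  qed
  define p where "p n = r ^ n * b (Suc n) * (1 - Re (w ^ Suc n))" for n
  define q where "q n = (real n)\<^sup>2 * (tail n * r ^ n)" for n
  have sums: "(\<lambda>n. (tail n * r ^ n - tail (Suc n) * r ^ Suc n) * (1 - Re (w ^ Suc n)))
      sums Re ((1 - w) * tail_gf (of_real r * w))"
    using sums_Re[OF abel_summation[of r w]] r w by simp
  have q_sums: "(\<lambda>n. q (Suc n)) sums (\<Sum>n. q n)"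
    using summable_sums[OF tail_second_moment(1)[of r]] r by (subst sums_Suc_iff) (simp add: q_def[abs_def])
  \<comment> \<open>Termwise comparison: \<open>p n\<close> is the positive part of the \<open>n\<close>-th term, of which only \<open>p 0\<close>, coming
    from \<open>b\<^sub>1\<close>, is kept; the factor \<open>1/r\<close> compensates the index shift in \<open>r\<^sup>n c\<^sub>n\<^sub>+\<^sub>1\<close>.\<close>
  have "\<beta> * (t\<^sup>2 / 2) - (r - 1) / r * (t\<^sup>2 / 2) * (\<Sum>n. q n) \<le> Re ((1 - w) * tail_gf (of_real r * w))"
  proof (rule sums_le[OF _ _ sums])
    show "(\<lambda>n. (if n \<in> {0} then \<beta> * (t\<^sup>2 / 2) else 0) - (r - 1) / r * (t\<^sup>2 / 2) * q (Suc n))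
        sums (\<beta> * (t\<^sup>2 / 2) - (r - 1) / r * (t\<^sup>2 / 2) * (\<Sum>n. q n))"
      using sums_If_finite_set[of "{0::nat}" "\<lambda>_. \<beta> * (t\<^sup>2 / 2)"]
      by (intro sums_diff sums_mult q_sums) simp_all
    fix n
    have 1: "(if n \<in> {0} then \<beta> * (t\<^sup>2 / 2) else 0) \<le> p n"
    proof (cases "n = 0")
      case True
      have "\<beta> * (t\<^sup>2 / 2) \<le> b 1 * (t\<^sup>2 / 2)"
        using b_1_ge by (intro mult_right_mono) auto
      also have "b 1 * (t\<^sup>2 / 2) = b 1 * (1 - Re w)"
        by (simp only: t_def one_minus_Re_unit[OF w])
      finally show ?thesis
        using True by (simp add: p_def)
    next
      case False
      then show ?thesis
        unfolding p_def using r b_nonneg Re_nonneg[of "Suc n"] by simp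
    qed
    have "(r - 1) * (tail (Suc n) * r ^ n) * (1 - Re (w ^ Suc n))
        \<le> (r - 1) * (tail (Suc n) * r ^ n) * ((real (Suc n))\<^sup>2 * (t\<^sup>2 / 2))"
      using r tail_nonneg by (intro mult_left_mono Re_le) auto
    also have "\<dots> = (r - 1) / r * (t\<^sup>2 / 2) * q (Suc n)"
      using r by (simp add: q_def)
    finally have 2: "(r - 1) * (tail (Suc n) * r ^ n) * (1 - Re (w ^ Suc n))
        \<le> (r - 1) / r * (t\<^sup>2 / 2) * q (Suc n)" .
    have "(tail n * r ^ n - tail (Suc n) * r ^ Suc n) * (1 - Re (w ^ Suc n))
        = p n - (r - 1) * (tail (Suc n) * r ^ n) * (1 - Re (w ^ Suc n))"
      unfolding p_def by (simp add: tail_Suc algebra_simps)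
    then show "(if n \<in> {0} then \<beta> * (t\<^sup>2 / 2) else 0) - (r - 1) / r * (t\<^sup>2 / 2) * q (Suc n)
        \<le> (tail n * r ^ n - tail (Suc n) * r ^ Suc n) * (1 - Re (w ^ Suc n))"
      using 1 2 by linarith
  qed
  moreover have "(r - 1) / r * (t\<^sup>2 / 2) * (\<Sum>n. q n) \<le> (r - 1) / r * (t\<^sup>2 / 2) * (r * A)"
    using tail_second_moment(2)[of r] r unfolding q_def A_def
    by (intro mult_left_mono) auto
  ultimately have "\<beta> * (t\<^sup>2 / 2) - (r - 1) * (t\<^sup>2 / 2) * A \<le> Re ((1 - w) * tail_gf (of_real r * w))"
    using r by simp
  moreover have "t * (t / 2 * (\<beta> - (r - 1) * A)) = \<beta> * (t\<^sup>2 / 2) - (r - 1) * (t\<^sup>2 / 2) * A"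
    by (simp add: power2_eq_square field_simps)
  ultimately have "t * (t / 2 * (\<beta> - (r - 1) * A)) \<le> Re ((1 - w) * tail_gf (of_real r * w))"
    by (simp only:)
  also have "\<dots> \<le> t * norm (tail_gf (of_real r * w))"
    using complex_Re_le_cmod[of "(1 - w) * tail_gf (of_real r * w)"] by (simp add: norm_mult t_def)
  finally have "t * (t / 2 * (\<beta> - (r - 1) * A)) \<le> t * norm (tail_gf (of_real r * w))" .
  then show ?thesis
    using t by (simp add: t_def)
qed simp

text \<open>In the notation of the introduction this is \<open>\<beta> - 2 (r - 1) A\<close>, the denominator in the constant
\<open>K\<^sub>1\<close>; it vanishes exactly at \<open>R\<^sub>1\<close>.\<close>

definition gap :: "real \<Rightarrow> real" where
  "gap r = \<beta> - 8 * renewal_N R L * exp (-2) * ((r - 1) / r) / (ln (R / r))\<^sup>2"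

text \<open>With \<open>g\<close> the gap, \<open>\<bar>c(z)\<bar> \<ge> 1 - t B\<close> and \<open>\<bar>c(z)\<bar> \<ge> t g / 2\<close>. Adding \<open>g\<close> times the first to \<open>2 B\<close>
times the second cancels \<open>t\<close>.\<close>

lemma tail_gf_lower_bound:
  assumes z: "1 \<le> norm z" "norm z < R" and gap: "gap (norm z) > 0"
  shows "norm (tail_gf z) > 0"
    and "1 / norm (tail_gf z) \<le> (\<beta> + 2 * ln (renewal_N R L) / ln (R / norm z)) / gap (norm z)"
proof -
  define r where "r = norm z"
  define w where "w = z / of_real r"
  have r: "1 \<le> r" "r < R" and w: "norm w = 1" and z_eq: "z = of_real r * w"
    using z by (auto simp: r_def w_def norm_divide)
  define t where "t = norm (1 - w)"
  define B where "B = ln (renewal_N R L) / ln (R / r)"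
  define A where "A = 4 * exp (-2) * renewal_N R L / (r * (ln (R / r))\<^sup>2)"
  define g where "g = gap r"
  define c where "c = norm (tail_gf z)"
  have g: "g > 0"
    using gap by (simp add: g_def r_def)
  have B: "B \<ge> 0"
    using N_ge_1 r by (simp add: B_def)
  have A: "A \<ge> 0"
    using N_ge_1 r by (simp add: A_def)
  have g_eq: "g = \<beta> - 2 * (r - 1) * A"
    using r by (simp add: g_def gap_def A_def field_simps)
  have 1: "c \<ge> 1 - t * B"
    using tail_gf_lower_bound_near_axis[OF r w] by (simp add: c_def z_eq t_def B_def)
  \<comment> \<open>The gap subtracts \<open>(r - 1) A\<close> twice, the bound away from the axis only once.\<close>
  have rA: "(r - 1) * A \<ge> 0"
    using A r by simp
  have "t / 2 * g \<le> t / 2 * (\<beta> - (r - 1) * A)"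
    unfolding g_eq using rA by (intro mult_left_mono) (auto simp: t_def algebra_simps)
  also have "\<dots> \<le> c"
    using tail_gf_lower_bound_off_axis[OF r w] by (simp add: c_def z_eq t_def A_def)
  finally have 2: "c \<ge> t / 2 * g" .
  have g_le: "g \<le> \<beta>"
    unfolding g_eq using A r by simp
  have "g = g * (1 - t * B) + 2 * B * (t / 2 * g)"
    by (simp add: algebra_simps)
  also have "\<dots> \<le> g * c + 2 * B * c"
    using 1 2 g B by (intro add_mono mult_left_mono) auto
  also have "\<dots> \<le> (\<beta> + 2 * B) * c"
    using g_le by (simp add: c_def mult_right_mono algebra_simps)
  finally have main: "g \<le> (\<beta> + 2 * B) * c" .
  have c: "c > 0"
    using main g by (cases "c = 0") (auto simp: c_def)
  then show "norm (tail_gf z) > 0"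
    by (simp add: c_def)
  have "1 / c \<le> (\<beta> + 2 * B) / g"
    using main c g by (simp add: field_simps)
  then show "1 / norm (tail_gf z) \<le> (\<beta> + 2 * ln (renewal_N R L) / ln (R / norm z)) / gap (norm z)"
    by (simp add: c_def B_def g_def r_def)
qed

lemma gap_pos:
  assumes "is_R1 \<beta> R L \<rho>" "1 \<le> r" "r < \<rho>"
  shows "gap r > 0"
proof -
  have \<rho>: "\<rho> < R" "(\<rho> - 1) / (\<rho> * (ln (R / \<rho>))\<^sup>2) = exp 2 * \<beta> / (8 * renewal_N R L)"
    using assms by (auto simp: is_R1_def)
  have N: "renewal_N R L > 0"
    using N_ge_1 by simp
  have "(r - 1) / (r * (ln (R / r))\<^sup>2) < exp 2 * \<beta> / (8 * renewal_N R L)"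
    using rate_strict_mono[of r \<rho> R] assms \<rho> by simp
  then have "8 * renewal_N R L * exp (-2) * ((r - 1) / (r * (ln (R / r))\<^sup>2))
      < 8 * renewal_N R L * exp (-2) * (exp 2 * \<beta> / (8 * renewal_N R L))"
    using N by (intro mult_strict_left_mono) auto
  also have "\<dots> = (exp (-2) * exp 2) * \<beta>"
    using N by simp
  also have "\<dots> = \<beta>"
    by (simp flip: exp_add)
  finally show ?thesis
    by (simp add: gap_def)
qed

lemma tail_gf_nonzero:
  assumes "is_R1 \<beta> R L \<rho>" "norm z < \<rho>"
  shows "tail_gf z \<noteq> 0"
proof (cases "norm z \<le> 1")
  case False
  then have "norm (tail_gf z) > 0"
    using assms by (intro tail_gf_lower_bound(1) gap_pos[OF assms(1)]) (auto simp: is_R1_def)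
  then show ?thesis
    by simp
qed (rule tail_gf_nonzero_unit_disc)

section \<open>The generating function of the renewal error\<close>

text \<open>Decomposition at the last renewal time not after \<open>n\<close>: it equals \<open>n - k\<close> with probability
\<open>c\<^sub>k u\<^sub>n\<^sub>-\<^sub>k\<close>. Analytically, the renewal equation says that the sum for \<open>n + 1\<close> equals the
sum for \<open>n\<close>.\<close>

lemma tail_convolution:
  fixes u :: "nat \<Rightarrow> real"
  assumes "u 0 = 1" and u_Suc: "\<And>n. u (Suc n) = (\<Sum>k\<le>n. b (Suc k) * u (n - k))"
  shows "(\<Sum>k\<le>n. tail k * u (n - k)) = 1"
proof (induction n)
  case (Suc n)
  have "(\<Sum>k\<le>Suc n. tail k * u (Suc n - k)) = u (Suc n) + (\<Sum>k\<le>n. tail (Suc k) * u (n - k))"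
    by (simp add: sum.atMost_Suc_shift del: sum.atMost_Suc)
  also have "\<dots> = (\<Sum>k\<le>n. tail k * u (n - k))"
    by (simp add: u_Suc tail_Suc left_diff_distrib sum_subtractf)
  finally show ?case
    using Suc by simp
qed (simp add: assms)

text \<open>The function \<open>(1/c(z) - 1/c(1)) / (1 - z)\<close>, with its removable singularity at 1 filled in. The
case distinction and the signs follow the form in which the removable singularity theorem
provides the extension.\<close>

definition error_gf :: "complex \<Rightarrow> complex" where
  "error_gf z = - (if z = 1 then deriv (\<lambda>z. 1 / tail_gf z) 1
            else 1 / tail_gf z / (z - 1) - 1 / tail_gf 1 / (z - 1))"

lemma error_gf_eq: "z \<noteq> 1 \<Longrightarrow> error_gf z = (1 / tail_gf z - 1 / of_real mean) / (1 - z)"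
  by (simp add: error_gf_def tail_gf_1 divide_simps) (simp add: algebra_simps)

lemma error_gf_holomorphic:
  assumes "is_R1 \<beta> R L \<rho>"
  shows "error_gf holomorphic_on ball 0 \<rho>"
proof -
  have "tail_gf holomorphic_on ball 0 \<rho>"
    using tail_gf_holomorphic by (rule holomorphic_on_subset) (use assms in \<open>auto simp: is_R1_def\<close>)
  then have "(\<lambda>z. 1 / tail_gf z) holomorphic_on ball 0 \<rho>"
    using tail_gf_nonzero[OF assms] by (intro holomorphic_intros) auto
  then have "(\<lambda>z. if z = 1 then deriv (\<lambda>z. 1 / tail_gf z) 1
      else 1 / tail_gf z / (z - 1) - 1 / tail_gf 1 / (z - 1)) holomorphic_on ball 0 \<rho>"
    by (rule pole_theorem_open) auto
  then show ?thesis
    unfolding error_gf_def[abs_def] by (rule holomorphic_on_minus)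
qed

lemma norm_error_gf_le_sphere:
  assumes \<rho>: "is_R1 \<beta> R L \<rho>" and r: "1 < r" "r < \<rho>" and z: "norm z = r"
  shows "norm (error_gf z) \<le> renewal_K1 \<beta> R L r"
proof -
  define Q where "Q = (\<beta> + 2 * ln (renewal_N R L) / ln (R / r)) / gap r"
  have "r < R"
    using \<rho> r by (simp add: is_R1_def)
  have "norm (1 / tail_gf z - 1 / of_real mean) \<le> norm (1 / tail_gf z) + norm (1 / complex_of_real mean)"
    by (rule norm_triangle_ineq4)
  also have "\<dots> \<le> Q + 1"
  proof (rule add_mono)
    show "norm (1 / tail_gf z) \<le> Q"
      using tail_gf_lower_bound(2)[of z] gap_pos[OF \<rho>, of r] z r \<open>r < R\<close>
      by (simp add: norm_divide Q_def)
    show "norm (1 / complex_of_real mean) \<le> 1"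
      using mean_ge_1 by (simp add: norm_divide)
  qed
  finally have num: "norm (1 / tail_gf z - 1 / of_real mean) \<le> Q + 1" .
  have den: "r - 1 \<le> norm (1 - z)"
    using norm_triangle_ineq2[of z 1] z by (simp add: norm_minus_commute)
  have "norm (error_gf z) = norm (1 / tail_gf z - 1 / of_real mean) / norm (1 - z)"
    using z r by (subst error_gf_eq) (auto simp: norm_divide)
  also have "\<dots> \<le> (Q + 1) / (r - 1)"
    using order_trans[OF norm_ge_zero num] num den r by (intro frac_le) auto
  also have "\<dots> = renewal_K1 \<beta> R L r"
    by (simp add: renewal_K1_def Q_def gap_def add.commute)
  finally show ?thesis .
qed

lemma norm_error_gf_le:
  assumes \<rho>: "is_R1 \<beta> R L \<rho>" and r: "1 < r" "r < \<rho>" and z: "norm z \<le> r"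
  shows "norm (error_gf z) \<le> renewal_K1 \<beta> R L r"
proof (rule maximum_modulus_frontier[where S = "cball 0 r" and f = error_gf])
  have "cball 0 r \<subseteq> ball (0::complex) \<rho>"
    using r by auto
  then have hol: "error_gf holomorphic_on cball 0 r"
    using error_gf_holomorphic[OF \<rho>] holomorphic_on_subset by blast
  show "error_gf holomorphic_on interior (cball 0 r)"
    using hol by (rule holomorphic_on_subset) (rule interior_subset)
  show "continuous_on (closure (cball 0 r)) error_gf"
    using hol by (simp add: holomorphic_on_imp_continuous_on)
  show "norm (error_gf w) \<le> renewal_K1 \<beta> R L r" if "w \<in> frontier (cball 0 r)" for w
    using that r norm_error_gf_le_sphere[OF \<rho> r] by (auto simp: frontier_cball)
qed (use z in auto)

text \<open>Both series become \<open>1 - c(z)/\<mu>\<close> when multiplied by the nonzero series \<open>(1 - z) c(z)\<close>: the Taylor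
series by the definition of the function, the other one by the convolution identity.\<close>

lemma fps_expansion_error_gf:
  fixes u :: "nat \<Rightarrow> real"
  assumes \<rho>: "is_R1 \<beta> R L \<rho>"
    and u: "u 0 = 1" "\<And>n. u (Suc n) = (\<Sum>k\<le>n. b (Suc k) * u (n - k))"
  shows "fps_expansion error_gf 0 = Abs_fps (\<lambda>n. of_real (u n - 1 / mean))" (is "?F = ?A")
proof -
  define U where "U = Abs_fps (\<lambda>n. complex_of_real (u n))"
  define ones :: "complex fps" where "ones = Abs_fps (\<lambda>_. 1)"
  define m where "m = complex_of_real (1 / mean)"
  have geom: "(1 - fps_X) * ones = 1"
    by (rule fps_ext) (auto simp: left_diff_distrib ones_def)
  have UC: "tail_fps * U = ones"
  proof (rule fps_ext)
    fix n
    have "fps_nth (tail_fps * U) n = of_real (\<Sum>k\<le>n. tail k * u (n - k))"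
      by (simp add: fps_mult_nth tail_fps_def U_def atLeast0AtMost)
    then show "fps_nth (tail_fps * U) n = fps_nth ones n"
      using tail_convolution[OF u] by (simp add: ones_def)
  qed
  have A_eq: "?A = U - fps_const m * ones"
    by (rule fps_ext) (simp add: U_def ones_def m_def)
  have "?A * ((1 - fps_X) * tail_fps)
      = (1 - fps_X) * (tail_fps * U) - fps_const m * ((1 - fps_X) * ones) * tail_fps"
    unfolding A_eq by (simp add: algebra_simps)
  also have "\<dots> = 1 - fps_const m * tail_fps"
    by (simp add: UC geom)
  finally have A: "?A * ((1 - fps_X) * tail_fps) = 1 - fps_const m * tail_fps" .
  have \<rho>1: "\<rho> > 1"
    using \<rho> by (simp add: is_R1_def)
  have "error_gf has_fps_expansion ?F"
    using \<rho>1 by (intro has_fps_expansion_fps_expansion[OF _ _ error_gf_holomorphic[OF \<rho>]]) auto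
  moreover have C: "tail_gf has_fps_expansion tail_fps"
    using tail_fps_radius R_gt_1 order_less_le_trans[of 0 "ereal R"]
    by (auto simp: has_fps_expansion_def tail_gf_def)
  ultimately have "(\<lambda>z. error_gf z * ((1 - z) * tail_gf z)) has_fps_expansion ?F * ((1 - fps_X) * tail_fps)"
    by (intro fps_expansion_intros)
  moreover have near_0: "eventually (\<lambda>z. error_gf z * ((1 - z) * tail_gf z) = 1 - m * tail_gf z) (nhds 0)"
  proof (rule eventually_nhds_in_open[THEN eventually_mono])
    fix z :: complex assume "z \<in> ball 0 1"
    then have "z \<noteq> 1" "tail_gf z \<noteq> 0"
      using tail_gf_nonzero_unit_disc[of z] by auto
    then show "error_gf z * ((1 - z) * tail_gf z) = 1 - m * tail_gf z"
      using mean_ge_1 by (simp add: error_gf_eq m_def field_simps)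
  qed auto
  ultimately have "(\<lambda>z. 1 - m * tail_gf z) has_fps_expansion ?F * ((1 - fps_X) * tail_fps)"
    by (simp only: has_fps_expansion_cong[OF near_0 refl])
  moreover have "(\<lambda>z. 1 - m * tail_gf z) has_fps_expansion 1 - fps_const m * tail_fps"
    by (intro fps_expansion_intros C)
  ultimately have "?F * ((1 - fps_X) * tail_fps) = ?A * ((1 - fps_X) * tail_fps)"
    unfolding A by (rule fps_expansion_unique_complex)
  moreover have "(1 - fps_X) * tail_fps \<noteq> 0"
  proof
    assume "(1 - fps_X) * tail_fps = 0"
    then have "fps_nth ((1 - fps_X) * tail_fps) 0 = 0"
      by simp
    then show False
      by (simp add: tail_fps_def)
  qed
  ultimately show ?thesis
    by simp
qed

text \<open>Since the Taylor series converges on a disc of radius larger than 1, its coefficients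
\<open>u\<^sub>n - 1/\<mu>\<close> tend to 0: the existence of the limit of \<open>u\<close> comes out of the same argument as its
rate.\<close>

lemma renewal_error_series:
  fixes u :: "nat \<Rightarrow> real"
  assumes \<rho>: "is_R1 \<beta> R L \<rho>"
    and u: "u 0 = 1" "\<And>n. u (Suc n) = (\<Sum>k\<le>n. b (Suc k) * u (n - k))"
  shows "u \<longlonglongrightarrow> 1 / mean"
    and "conv_radius (\<lambda>n. complex_of_real (u n - 1 / mean)) \<ge> ereal \<rho>"
    and "norm z < \<rho> \<Longrightarrow> (\<Sum>n. complex_of_real (u n - 1 / mean) * z ^ n) = error_gf z"
proof -
  have hol: "error_gf holomorphic_on eball 0 (ereal \<rho>)"
    using error_gf_holomorphic[OF \<rho>] by simp
  show radius: "conv_radius (\<lambda>n. complex_of_real (u n - 1 / mean)) \<ge> ereal \<rho>"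
    using conv_radius_fps_expansion[OF hol] by (simp add: fps_expansion_error_gf[OF \<rho> u] fps_conv_radius_def)
  show "(\<Sum>n. complex_of_real (u n - 1 / mean) * z ^ n) = error_gf z" if "norm z < \<rho>"
    using eval_fps_expansion'[OF hol, of z] that by (simp add: fps_expansion_error_gf[OF \<rho> u] eval_fps_def)
  have "ereal (norm (1::complex)) < conv_radius (\<lambda>n. complex_of_real (u n - 1 / mean))"
    using radius \<rho> by (intro order_less_le_trans[OF _ radius]) (simp add: is_R1_def)
  then have "summable (\<lambda>n. complex_of_real (u n - 1 / mean) * 1 ^ n)"
    by (rule summable_in_conv_radius)
  then have "(\<lambda>n. complex_of_real (u n - 1 / mean)) \<longlonglongrightarrow> of_real 0"
    by (simp add: summable_LIMSEQ_zero del: of_real_diff)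
  then have "(\<lambda>n. u n - 1 / mean) \<longlonglongrightarrow> 0"
    by (simp only: tendsto_of_real_iff)
  then show "u \<longlonglongrightarrow> 1 / mean"
    by (rule LIM_zero_cancel)
qed

end

theorem theorem3p2:
  fixes M :: "'a measure" and V :: "nat \<Rightarrow> 'a \<Rightarrow> nat" and b :: "nat \<Rightarrow> real"
    and R L \<beta> :: real
  assumes "renewal_process M V b"
    and "R > 1" and "\<beta> > 0"
    and "summable (\<lambda>n. b (Suc n) * R ^ Suc n)"
    and "(\<Sum>n. b (Suc n) * R ^ Suc n) \<le> L"
    and "b 1 \<ge> \<beta>"
  shows "renewal_N R L \<ge> 1
    \<and> (\<exists>!r. is_R1 \<beta> R L r)
    \<and> convergent (renewal_seq M V)
    \<and> conv_radius (\<lambda>n. complex_of_real (renewal_seq M V n - lim (renewal_seq M V)))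
        \<ge> ereal (renewal_R1 \<beta> R L)
    \<and> (\<forall>r. 1 < r \<and> r < renewal_R1 \<beta> R L \<longrightarrow>
         (\<forall>z::complex. norm z \<le> r \<longrightarrow>
            norm (\<Sum>n. complex_of_real (renewal_seq M V n - lim (renewal_seq M V)) * z ^ n)
              \<le> renewal_K1 \<beta> R L r))"
proof -
  interpret renewal_process M V b
    by fact
  interpret light_tailed_increments b R L \<beta>
  proof
    show "b (Suc n) \<ge> 0" for n
      by (simp add: increment_prob)
  qed (use assms increment_dist_sums in auto)
  have ex1: "\<exists>!r. is_R1 \<beta> R L r"
    unfolding is_R1_def using N_ge_1 R_gt_1 \<beta>_pos by (intro rate_equation_ex1) auto
  define \<rho> where "\<rho> = renewal_R1 \<beta> R L"
  have \<rho>: "is_R1 \<beta> R L \<rho>"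
    unfolding \<rho>_def renewal_R1_def using ex1 by (rule theI')
  note error_series = renewal_error_series[OF \<rho> renewal_seq_0 renewal_equation]
  have lim: "lim (renewal_seq M V) = 1 / mean"
    using error_series(1) by (rule limI)
  have "convergent (renewal_seq M V)"
    using error_series(1) by (rule convergentI)
  moreover have "norm (\<Sum>n. complex_of_real (renewal_seq M V n - 1 / mean) * z ^ n) \<le> renewal_K1 \<beta> R L r"
    if "1 < r" "r < \<rho>" "norm z \<le> r" for r and z :: complex
    using norm_error_gf_le[OF \<rho> that] error_series(3)[of z] that by simp
  ultimately show ?thesis
    using N_ge_1 ex1 error_series(2) unfolding lim \<rho>_def by blast
qed

end
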